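(* Let $X$ be a smooth Banach space over $\mathbb{K}$ of dimension at least two such that $\operatorname{StrExp}(B_X)\neq\emptyset$. Then $X$ does not have numerical index one.
   Context: $\mathbb{K}$ is $\mathbb{R}$ or $\mathbb{C}$. $X$ is smooth if for every non-zero $z\in X$ the set $\{\phi\in X^*\colon\|\phi\|=1,\ \phi(z)=\|z\|\}$ is a singleton. $\operatorname{StrExp}(B_X)$ is the set of strongly exposed points of the closed unit ball $B_X$: $x_0\in B_X$ belongs to it if there is $f_0\in X^*$, $\|f_0\|=1$, such that whenever $\{x_n\}\subset B_X$ and $\lim\operatorname{Re}f_0(x_n)=1$, then $\lim x_n=x_0$ in norm. For a bounded linear operator $T$ on $X$, the numerical radius is $v(T)=\sup\{|x^*(Tx)|\colon x\in X,\ x^*\in X^*,\ \|x\|=\|x^*\|=x^*(x)=1\}$, and the numerical index of $X$ is $n(X)=\inf\{v(T)\colon T\in\mathcal{L}(X),\ \|T\|=1\}$; $X$ has numerical index one if $n(X)=1$, i.e. $v(T)=\|T\|$ for all $T\in\mathcal{L}(X)$. *)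

theory Defs
  imports "HOL-Analysis.Analysis"
begin

text \<open>
  The scalar field is \<open>real\<close> or \<open>complex\<close>; the notions below are set up for both at once, over a
  normed field that is also a real inner product space.  On both fields the real part of a scalar
  is its inner product with 1.
\<close>

definition scalar_re :: "'k::{real_normed_field, real_inner} \<Rightarrow> real"
  where "scalar_re a = a \<bullet> 1"

lemma scalar_re_real [simp]: "scalar_re (a :: real) = a"
  by (simp add: scalar_re_def)

lemma scalar_re_complex [simp]: "scalar_re (a :: complex) = Re a"
  by (simp add: scalar_re_def inner_complex_def)

text \<open>
  A Banach space over \<open>'k\<close> is a real Banach space (class \<open>banach\<close>) with a multiplication by scalars
  from \<open>'k\<close> that extends the real one and for which the norm is homogeneous.
\<close>

locale banach_space_over = vector_space scale
  for scale :: "'k::{real_normed_field, real_inner} \<Rightarrow> 'x::banach \<Rightarrow> 'x" +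
  assumes scale_of_real: "scale (of_real r) x = r *\<^sub>R x"
    and norm_scale: "norm (scale a x) = norm a * norm x"
begin

definition dual :: "('x \<Rightarrow> 'k) set"
  where "dual = {f. bounded_linear f \<and> (\<forall>a x. f (scale a x) = a * f x)}"

definition operators :: "('x \<Rightarrow> 'x) set"
  where "operators = {T. bounded_linear T \<and> (\<forall>a x. T (scale a x) = scale a (T x))}"

text \<open>Independent sets rather than \<open>dim\<close>, which is 0 on infinite-dimensional spaces.\<close>

definition dim_at_least :: "nat \<Rightarrow> bool"
  where "dim_at_least n \<longleftrightarrow> (\<exists>B. independent B \<and> finite B \<and> n \<le> card B)"

definition smooth :: bool
  where "smooth \<longleftrightarrow>
    (\<forall>z. z \<noteq> 0 \<longrightarrow> is_singleton {\<phi> \<in> dual. onorm \<phi> = 1 \<and> \<phi> z = of_real (norm z)})"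

definition str_exp :: "'x set"
  where "str_exp = {x0 \<in> cball 0 1. \<exists>f0 \<in> dual. onorm f0 = 1 \<and>
    (\<forall>x :: nat \<Rightarrow> 'x. (\<forall>n. x n \<in> cball 0 1) \<and> (\<lambda>n. scalar_re (f0 (x n))) \<longlonglongrightarrow> 1
      \<longrightarrow> x \<longlonglongrightarrow> x0)}"

definition numerical_radius :: "('x \<Rightarrow> 'x) \<Rightarrow> real"
  where "numerical_radius T =
    Sup {norm (f (T x)) | x f. f \<in> dual \<and> norm x = 1 \<and> onorm f = 1 \<and> f x = 1}"

definition numerical_index :: real
  where "numerical_index = Inf {numerical_radius T | T. T \<in> operators \<and> onorm T = 1}"

end

lemma banach_space_over_scaleR: "banach_space_over ((*\<^sub>R) :: real \<Rightarrow> 'x::banach \<Rightarrow> 'x)"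
  by unfold_locales (simp_all add: algebra_simps)

end

theory Submission
  imports Defs
begin

text \<open>
  Let \<open>f0\<close> strongly expose \<open>x0\<close> and let \<open>y\<close> be a unit vector in the kernel of \<open>f0\<close>.  If the rank one
  operator \<open>T x = f0(x) y\<close>, of norm one, had numerical radius one, there would be states
  \<open>(x n, g n)\<close> with \<open>\<bar>f0 (x n)\<bar> \<longrightarrow> 1\<close> and \<open>\<bar>g n y\<bar> \<longrightarrow> 1\<close>.  After a rotation of each state,
  strong exposition gives \<open>x n \<longrightarrow> x0\<close>, and then \<open>g n x0 \<longrightarrow> 1\<close>.  A weak* cluster point \<open>\<phi>\<close> of the
  \<open>g n\<close> has norm one and satisfies \<open>\<phi> x0 = 1\<close> and \<open>\<bar>\<phi> y\<bar> = 1\<close>; so \<open>\<phi>\<close> and \<open>f0\<close> are distinct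
  supporting functionals at \<open>x0\<close>, which contradicts smoothness.
\<close>

lemma scalar_re_of_real:
  "scalar_re (of_real r :: 'k::{real_normed_field, real_inner}) = r"
  by (simp add: scalar_re_def of_real_def power2_norm_eq_inner [symmetric])

text \<open>
  A finer filter rather than a subsequence, since \<open>'a\<close> need not be countable.
\<close>

lemma pointwise_bounded_cluster_point:
  fixes h :: "nat \<Rightarrow> 'a \<Rightarrow> 'k::heine_borel"
  assumes bounded: "\<And>x. bounded (range (\<lambda>n. h n x))"
  obtains G \<phi> where "G \<noteq> bot" "G \<le> sequentially" "\<And>x. ((\<lambda>n. h n x) \<longlongrightarrow> \<phi> x) G"
proof -
  \<comment> \<open>Bounded orbits in a Heine-Borel field have compact closures, so by Tychonoff
    their product is compact for pointwise convergence. The sequence \<open>h\<close> lives in it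
    and hence has a cluster point.\<close>
  define K where "K = PiE UNIV (\<lambda>x. closure (range (\<lambda>n. h n x)))"
  have "compact K"
    using bounded
    unfolding K_def compactin_euclidean_iff [symmetric] euclidean_product_topology [symmetric]
    by (subst compactin_PiE) simp
  moreover have "h n \<in> K" for n
    using closure_subset by (fastforce simp: K_def)
  ultimately obtain \<phi> where \<phi>: "inf (nhds \<phi>) (filtermap h sequentially) \<noteq> bot"
    unfolding compact_filter
    by (metis (no_types, lifting) always_eventually eventually_filtermap filtermap_bot_iff
        sequentially_bot)
  \<comment> \<open>Pulling the neighbourhoods of \<open>\<phi>\<close> back along \<open>h\<close>
    forces convergence to \<open>\<phi>\<close>; \<open>G\<close> stays proper exactly because
    \<open>\<phi>\<close> is a cluster point.\<close>
  define G where "G = inf sequentially (filtercomap h (nhds \<phi>))"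
  have "G \<noteq> bot"
  proof
    assume "G = bot"
    then obtain P Q where P: "eventually P sequentially" and Q: "eventually Q (nhds \<phi>)"
      and PQ: "\<And>n. P n \<Longrightarrow> Q (h n) \<Longrightarrow> False"
      unfolding G_def trivial_limit_def eventually_inf eventually_filtercomap by meson
    have "eventually (\<lambda>\<psi>. \<not> Q \<psi>) (filtermap h sequentially)"
      unfolding eventually_filtermap using P by (rule eventually_mono) (use PQ in blast)
    with Q have "eventually (\<lambda>_. False) (inf (nhds \<phi>) (filtermap h sequentially))"
      unfolding eventually_inf by blast
    with \<phi> show False by (simp add: trivial_limit_def)
  qed
  moreover have "G \<le> sequentially" by (simp add: G_def)
  moreover have "((\<lambda>n. h n x) \<longlongrightarrow> \<phi> x) G" for x
  proof -
    have "(h \<longlongrightarrow> \<phi>) G"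
      unfolding G_def by (rule tendsto_mono [OF inf_le2]) (rule filterlim_filtercomap)
    moreover have "((\<lambda>\<psi> :: 'a \<Rightarrow> 'k. \<psi> x) \<longlongrightarrow> \<phi> x) (at \<phi>)"
      using continuous_on_product_coordinates [of x] unfolding continuous_on_def by blast
    ultimately show ?thesis by (rule tendsto_compose [rotated])
  qed
  ultimately show thesis by (rule that)
qed

section \<open>Functionals, their pointwise limits, and rank one operators\<close>

context banach_space_over
begin

lemma dual_linear:
  assumes "f \<in> dual"
  shows "bounded_linear f" "f (scale a x) = a * f x"
  using assms by (auto simp: dual_def)

lemma norm_dual_le:
  assumes "f \<in> dual" "onorm f \<le> 1"
  shows "norm (f x) \<le> norm x"
  using onorm [OF dual_linear(1) [OF assms(1)], of x] mult_right_mono [OF assms(2), of "norm x"]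
  by simp

text \<open>The linear identities survive because limits along a proper filter are unique; the
  bound, uniform in \<open>n\<close>, keeps the limit continuous.\<close>

lemma dual_limit:
  assumes "G \<noteq> bot" and h: "\<And>n. h n \<in> dual" and lim: "\<And>x. ((\<lambda>n. h n x) \<longlongrightarrow> \<phi> x) G"
    and le: "\<And>n x. norm (h n x) \<le> norm x"
  shows "\<phi> \<in> dual" "norm (\<phi> x) \<le> norm x"
proof -
  have lin: "linear (h n)" for n
    using h dual_linear(1) bounded_linear.linear by blast
  have bound: "norm (\<phi> x) \<le> norm x" for x
    using le by (intro tendsto_upperbound [OF tendsto_norm [OF lim] _ \<open>G \<noteq> bot\<close>]) simp
  then show "norm (\<phi> x) \<le> norm x" .
  have "\<phi> (x + y) = \<phi> x + \<phi> y" for x y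
    using lim [of "x + y"] tendsto_add [OF lim [of x] lim [of y]]
    unfolding linear_add [OF lin] by (rule tendsto_unique [OF \<open>G \<noteq> bot\<close>])
  moreover have hom: "\<phi> (scale a x) = a * \<phi> x" for a x
    using lim [of "scale a x"] tendsto_mult_left [OF lim [of x], of a]
    unfolding dual_linear(2) [OF h] by (rule tendsto_unique [OF \<open>G \<noteq> bot\<close>])
  moreover have "\<phi> (r *\<^sub>R x) = r *\<^sub>R \<phi> x" for r x
    using hom [of "of_real r" x] by (simp add: scale_of_real scaleR_conv_of_real)
  ultimately have "bounded_linear \<phi>"
    using bound by (intro bounded_linear_intro [where K = 1]) auto
  with hom show "\<phi> \<in> dual" by (simp add: dual_def)
qed

lemma rank_one_operator:
  assumes f: "f \<in> dual" and y: "norm y = 1"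
  shows "(\<lambda>x. scale (f x) y) \<in> operators" "onorm (\<lambda>x. scale (f x) y) = onorm f"
proof -
  note lin = dual_linear [OF f]
  have "bounded_linear (\<lambda>x. scale (f x) y)"
  proof (rule bounded_linear_intro [where K = "onorm f"])
    show "scale (f (u + v)) y = scale (f u) y + scale (f v) y" for u v
      by (simp add: linear_add [OF bounded_linear.linear [OF lin(1)]] scale_left_distrib)
    show "scale (f (r *\<^sub>R u)) y = r *\<^sub>R scale (f u) y" for r u
      by (simp add: linear_scale [OF bounded_linear.linear [OF lin(1)]] scaleR_conv_of_real
          scale_of_real flip: scale_scale)
    show "norm (scale (f u) y) \<le> norm u * onorm f" for u
      using onorm [OF lin(1), of u] by (simp add: norm_scale y mult.commute)
  qed
  then show "(\<lambda>x. scale (f x) y) \<in> operators"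
    by (simp add: operators_def lin(2))
  show "onorm (\<lambda>x. scale (f x) y) = onorm f"
    by (simp add: onorm_def norm_scale y)
qed

section \<open>Numerical radius and numerical index\<close>

lemma norm_state_le:
  assumes "T \<in> operators" "f \<in> dual" "norm x = 1" "onorm f = 1"
  shows "norm (f (T x)) \<le> onorm T"
  using norm_dual_le [OF assms(2), of "T x"] onorm [of T x] assms by (simp add: operators_def)

text \<open>\<open>Sup\<close> and \<open>Inf\<close> on the reals are informative only for
  nonempty, suitably bounded sets. The state \<open>(z, g)\<close> makes every set of values
  nonempty; so all radii are nonnegative and the infimum is a genuine lower bound.\<close>

lemma numerical_index_witness:
  assumes state: "g \<in> dual" "norm z = 1" "onorm g = 1" "g z = 1"
    and T: "T \<in> operators" "onorm T = 1" and "r < numerical_index"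
  obtains f x where "f \<in> dual" "norm x = 1" "onorm f = 1" "f x = 1" "r < norm (f (T x))"
proof -
  let ?V = "\<lambda>T. {norm (f (T x)) | x f. f \<in> dual \<and> norm x = 1 \<and> onorm f = 1 \<and> f x = 1}"
  have bdd: "bdd_above (?V S)" if "S \<in> operators" for S
    using norm_state_le [OF that] by (auto intro!: bdd_aboveI [where M = "onorm S"])
  have mem: "norm (g (S z)) \<in> ?V S" for S
    using state by blast
  have "0 \<le> numerical_radius S" if "S \<in> operators" for S
    unfolding numerical_radius_def
    using cSup_upper [OF mem bdd [OF that]] by (rule order_trans [OF norm_ge_zero])
  then have "bdd_below {numerical_radius S | S. S \<in> operators \<and> onorm S = 1}"
    by (auto intro!: bdd_belowI [where m = 0])
  then have "numerical_index \<le> numerical_radius T"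
    unfolding numerical_index_def using T by (intro cInf_lower) auto
  with \<open>r < numerical_index\<close> have "r < Sup (?V T)"
    by (simp add: numerical_radius_def)
  moreover have "?V T \<noteq> {}"
    using mem [of T] by (metis empty_iff)
  ultimately obtain v where "v \<in> ?V T" "r < v"
    by (rule less_cSupE)
  then show thesis using that by blast
qed

lemma dual_kernel_unit_vector:
  assumes f: "f \<in> dual" and "dim_at_least 2"
  obtains y where "f y = 0" "norm y = 1"
proof -
  note lin = dual_linear [OF f]
  obtain B where B: "independent B" "finite B" "2 \<le> card B"
    using assms(2) by (auto simp: dim_at_least_def)
  then obtain a b where ab: "a \<in> B" "b \<in> B" "a \<noteq> b"
    by (metis card_le_Suc0_iff_eq not_less_eq_eq numeral_2_eq_2)
  obtain v where v: "v \<noteq> 0" "f v = 0"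
  proof (cases "f b = 0")
    case True
    then show thesis
      using that [of b] B(1) ab dependent_zero by blast
  next
    case False
    \<comment> \<open>Elimination: this coefficient makes \<open>f\<close> vanish at
      \<open>a - scale ?c b\<close>, which is nonzero by independence.\<close>
    let ?c = "f a / f b"
    have "a \<noteq> scale ?c b"
    proof
      assume "a = scale ?c b"
      then have "a \<in> span (B - {a})"
        using ab by (metis insertE insert_Diff span_base span_scale)
      then show False
        using B(1) ab by (auto simp: dependent_def)
    qed
    moreover have "f (a - scale ?c b) = 0"
      using False by (simp add: linear_diff [OF bounded_linear.linear [OF lin(1)]] lin(2))
    ultimately show thesis
      using that [of "a - scale ?c b"] by simp
  qed
  have "f (inverse (norm v) *\<^sub>R v) = 0"
    using v by (simp add: linear_scale [OF bounded_linear.linear [OF lin(1)]])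
  moreover have "norm (inverse (norm v) *\<^sub>R v) = 1"
    using v by simp
  ultimately show thesis by (rule that)
qed

lemma smooth_unique:
  assumes "smooth" "z \<noteq> 0" and "f \<in> dual" "onorm f = 1" "f z = of_real (norm z)"
    and "g \<in> dual" "onorm g = 1" "g z = of_real (norm z)"
  shows "f = g"
proof -
  obtain \<xi> where \<xi>: "{\<phi> \<in> dual. onorm \<phi> = 1 \<and> \<phi> z = of_real (norm z)} = {\<xi>}"
    using assms(1,2) unfolding smooth_def is_singleton_def by blast
  have "f \<in> {\<xi>}" "g \<in> {\<xi>}"
    unfolding \<xi> [symmetric] using assms by simp_all
  then show ?thesis by simp
qed

text \<open>Strong exposition controls only the real part of a functional. A unimodular
  \<open>u\<close> turns \<open>f x\<close> into its modulus; replacing \<open>x\<close> by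
  \<open>scale u x\<close> and \<open>g\<close> by \<open>g / u\<close> preserves the state and all
  moduli of \<open>g\<close>.\<close>

lemma rotate_state:
  assumes g: "g \<in> dual" "onorm g = 1" "g x = 1" and "norm x = 1" and f: "f \<in> dual" "f x \<noteq> 0"
  obtains h z where "h \<in> dual" "onorm h = 1" "h z = 1" "norm z = 1"
    "f z = of_real (norm (f x))" "\<And>y. norm (h y) = norm (g y)"
proof -
  define u where "u = of_real (norm (f x)) / f x"
  have u: "norm u = 1" "u \<noteq> 0" "u * f x = of_real (norm (f x))"
    using f(2) by (auto simp: u_def norm_divide)
  have "(\<lambda>y. g y / u) \<in> dual"
    using dual_linear [OF g(1)] bounded_linear_compose [OF bounded_linear_divide]
    by (auto simp: dual_def)
  moreover have "onorm (\<lambda>y. g y / u) = 1"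
    using g(2) by (simp add: onorm_def norm_divide u)
  ultimately show thesis
    using that [of "\<lambda>y. g y / u" "scale u x"] g \<open>norm x = 1\<close> u
    by (simp add: dual_linear(2) f(1) norm_scale norm_divide)
qed

end

text \<open>The class \<open>euclidean_space\<close> covers both \<open>real\<close> and
  \<open>complex\<close> and supplies the Heine-Borel property used for the cluster point.\<close>

theorem numerical_index_neq_1:
  fixes scale :: "'k::{real_normed_field, euclidean_space} \<Rightarrow> 'x::banach \<Rightarrow> 'x"
  assumes "banach_space_over scale"
    and smooth: "banach_space_over.smooth scale"
    and dim: "banach_space_over.dim_at_least scale 2"
    and str_exp: "banach_space_over.str_exp scale \<noteq> {}"
  shows "banach_space_over.numerical_index scale \<noteq> 1"
proof
  interpret banach_space_over scale by fact
  assume index: "numerical_index = 1"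
  obtain x0 f0 where x0: "norm x0 \<le> 1" and f0: "f0 \<in> dual" "onorm f0 = 1"
    and exposed: "\<And>x :: nat \<Rightarrow> 'x. (\<And>n. norm (x n) \<le> 1) \<Longrightarrow>
      (\<lambda>n. scalar_re (f0 (x n))) \<longlonglongrightarrow> 1 \<Longrightarrow> x \<longlonglongrightarrow> x0"
    using str_exp unfolding str_exp_def mem_cball_0 by blast
  obtain y where y: "f0 y = 0" "norm y = 1"
    using dual_kernel_unit_vector [OF f0(1) dim] .
  then have "y \<noteq> 0" by auto
  \<comment> \<open>Smoothness at \<open>y\<close> yields a norming functional there, hence the
    state that \<open>numerical_index_witness\<close> asks for.\<close>
  with smooth obtain \<psi> where \<psi>: "\<psi> \<in> dual" "onorm \<psi> = 1" "\<psi> y = 1"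
    using y(2) unfolding smooth_def is_singleton_def
    by (metis (mono_tags, lifting) insertI1 mem_Collect_eq of_real_1)
  define T where "T = (\<lambda>x. scale (f0 x) y)"
  have T: "T \<in> operators" "onorm T = 1"
    using rank_one_operator [OF f0(1) y(2)] f0(2) by (auto simp: T_def)
  \<comment> \<open>With \<open>Suc n\<close> the values stay at most 1, so the strict bound
    \<open>1 - \<epsilon> n < norm (f0 x)\<close> gives \<open>f0 x \<noteq> 0\<close> even for
    \<open>n = 0\<close>.\<close>
  define \<epsilon> :: "nat \<Rightarrow> real" where "\<epsilon> n = 1 / real (Suc n)" for n
  have \<epsilon>: "\<epsilon> \<longlonglongrightarrow> 0" "0 < \<epsilon> n" "\<epsilon> n \<le> 1" for n
    unfolding \<epsilon>_def using LIMSEQ_inverse_real_of_nat by (auto simp: inverse_eq_divide)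
  have "\<exists>h z. h \<in> dual \<and> onorm h = 1 \<and> h z = 1 \<and> norm z = 1 \<and>
      f0 z = of_real (norm (f0 z)) \<and> 1 - \<epsilon> n < norm (f0 z) \<and> 1 - \<epsilon> n < norm (h y)" for n
  proof -
    obtain g x where g: "g \<in> dual" "norm x = 1" "onorm g = 1" "g x = 1"
      and large: "1 - \<epsilon> n < norm (g (T x))"
      using numerical_index_witness [OF \<psi>(1) y(2) \<psi>(2,3) T, of "1 - \<epsilon> n"] index \<epsilon>(2) by auto
    have "norm (g (T x)) = norm (f0 x) * norm (g y)"
      by (simp add: T_def dual_linear(2) [OF g(1)] norm_mult)
    moreover have "norm (f0 x) \<le> 1" "norm (g y) \<le> 1"
      using norm_dual_le [OF f0(1), of x] norm_dual_le [OF g(1), of y] f0(2) g y(2) by auto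
    \<comment> \<open>A product of two numbers in [0,1] is at most each factor.\<close>
    ultimately have *: "1 - \<epsilon> n < norm (f0 x)" "1 - \<epsilon> n < norm (g y)"
      using large mult_left_le [of "norm (g y)" "norm (f0 x)"]
        mult_left_le_one_le [of "norm (g y)" "norm (f0 x)"] by auto
    then have "f0 x \<noteq> 0" using \<epsilon>(3) [of n] by auto
    then obtain h z where "h \<in> dual" "onorm h = 1" "h z = 1" "norm z = 1"
      "f0 z = of_real (norm (f0 x))" "\<And>y. norm (h y) = norm (g y)"
      using rotate_state [OF g(1,3,4,2) f0(1)] by blast
    with * show ?thesis by (intro exI [of _ h] exI [of _ z]) simp
  qed
  then obtain h z where h: "\<And>n. h n \<in> dual" "\<And>n. onorm (h n) = 1"
    and z: "\<And>n. h n (z n) = 1" "\<And>n. norm (z n) = 1" "\<And>n. f0 (z n) = of_real (norm (f0 (z n)))"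
    and f0z: "\<And>n. 1 - \<epsilon> n < norm (f0 (z n))" and hy: "\<And>n. 1 - \<epsilon> n < norm (h n y)"
    by metis
  have h_le: "norm (h n x) \<le> norm x" for n x
    using norm_dual_le h by simp
  have to_1: "(\<lambda>n. 1 - \<epsilon> n) \<longlonglongrightarrow> 1"
    using tendsto_diff [OF tendsto_const \<epsilon>(1), of 1] by simp
  have "norm (f0 (z n)) \<le> 1" for n
    using norm_dual_le [OF f0(1), of "z n"] f0(2) z(2) by simp
  then have norm_f0z: "(\<lambda>n. norm (f0 (z n))) \<longlonglongrightarrow> 1"
    using f0z by (intro tendsto_sandwich [OF _ _ to_1 tendsto_const]) (auto intro!: always_eventually less_imp_le)
  moreover have "scalar_re (f0 (z n)) = norm (f0 (z n))" for n
    using z(3) [of n] scalar_re_of_real by metis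
  ultimately have zx0: "z \<longlonglongrightarrow> x0"
    using z(2) by (intro exposed) simp_all
  have "(\<lambda>n. f0 (z n)) \<longlonglongrightarrow> f0 x0"
    using zx0 by (rule bounded_linear.tendsto [OF dual_linear(1) [OF f0(1)]])
  moreover have "(\<lambda>n. f0 (z n)) \<longlonglongrightarrow> 1"
    using tendsto_of_real [OF norm_f0z, where 'a = 'k] z(3) by simp
  ultimately have f0x0: "f0 x0 = 1"
    using LIMSEQ_unique by blast
  \<comment> \<open>Since \<open>f0\<close> has norm one, \<open>f0 x0 = 1\<close> puts
    \<open>x0\<close> on the unit sphere, so \<open>f0\<close> supports the ball at
    \<open>x0\<close>.\<close>
  then have norm_x0: "norm x0 = 1"
    using norm_dual_le [OF f0(1), of x0] f0(2) x0 by simp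
  have hx0: "(\<lambda>n. h n x0) \<longlonglongrightarrow> 1"
  proof (rule LIM_zero_cancel, rule Lim_null_comparison)
    \<comment> \<open>Because \<open>h n (z n) = 1\<close>, the difference is
      \<open>h n (x0 - z n)\<close>, and \<open>h n\<close> has norm one.\<close>
    have "norm (h n x0 - 1) \<le> norm (z n - x0)" for n
      using h_le [of n "x0 - z n"] linear_diff [OF bounded_linear.linear [OF dual_linear(1) [OF h(1)]]]
      by (simp add: z(1) norm_minus_commute)
    then show "\<forall>\<^sub>F n in sequentially. norm (h n x0 - 1) \<le> norm (z n - x0)"
      by simp
    show "(\<lambda>n. norm (z n - x0)) \<longlonglongrightarrow> 0"
      using zx0 by (simp add: LIM_zero tendsto_norm_zero)
  qed
  have hy1: "(\<lambda>n. norm (h n y)) \<longlonglongrightarrow> 1"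
    using hy h_le [of _ y] y(2)
    by (intro tendsto_sandwich [OF _ _ to_1 tendsto_const]) (auto intro!: always_eventually less_imp_le)
  have "bounded (range (\<lambda>n. h n x))" for x
    using h_le by (auto intro!: boundedI)
  then obtain G \<phi> where G: "G \<noteq> bot" "G \<le> sequentially"
    and lim: "\<And>x. ((\<lambda>n. h n x) \<longlongrightarrow> \<phi> x) G"
    using pointwise_bounded_cluster_point [of h] by blast
  note \<phi> = dual_limit [OF G(1) h(1) lim h_le]
  have \<phi>x0: "\<phi> x0 = 1"
    using tendsto_unique [OF G(1) lim tendsto_mono [OF G(2) hx0]] .
  have \<phi>y: "norm (\<phi> y) = 1"
    using tendsto_unique [OF G(1) tendsto_norm [OF lim] tendsto_mono [OF G(2) hy1]] .
  have "onorm \<phi> = 1"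
  proof (rule antisym)
    show "onorm \<phi> \<le> 1" using \<phi>(2) by (intro onorm_bound) auto
    show "1 \<le> onorm \<phi>"
      using onorm [OF dual_linear(1) [OF \<phi>(1)], of x0] \<phi>x0 norm_x0 by simp
  qed
  moreover have "x0 \<noteq> 0" using norm_x0 by auto
  ultimately have "\<phi> = f0"
    using smooth_unique [OF smooth, of x0 \<phi> f0] \<phi>(1) \<phi>x0 f0 f0x0 norm_x0 by simp
  with \<phi>y y(1) show False by simp
qed

theorem corollary5p12:
  fixes scale\<^sub>R :: "real \<Rightarrow> 'x::banach \<Rightarrow> 'x"
    and scale\<^sub>C :: "complex \<Rightarrow> 'y::banach \<Rightarrow> 'y"
  shows "(banach_space_over scale\<^sub>R
        \<and> banach_space_over.smooth scale\<^sub>R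
        \<and> banach_space_over.dim_at_least scale\<^sub>R 2
        \<and> banach_space_over.str_exp scale\<^sub>R \<noteq> {}
        \<longrightarrow> banach_space_over.numerical_index scale\<^sub>R \<noteq> 1)
    \<and> (banach_space_over scale\<^sub>C
        \<and> banach_space_over.smooth scale\<^sub>C
        \<and> banach_space_over.dim_at_least scale\<^sub>C 2
        \<and> banach_space_over.str_exp scale\<^sub>C \<noteq> {}
        \<longrightarrow> banach_space_over.numerical_index scale\<^sub>C \<noteq> 1)"
  using numerical_index_neq_1 [of scale\<^sub>R] numerical_index_neq_1 [of scale\<^sub>C] by blast

end
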